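(* The satisfiability problem for $\mathcal{L}$ is decidable: there is an algorithm which, given a formula $\varphi\in\mathcal{L}$, decides whether there exist a WTS $\mathcal{M}$ and a state $s$ of $\mathcal{M}$ with $\mathcal{M},s\models\varphi$.
   Context: Fix a countable set $\mathcal{AP}$ of atomic propositions. A weighted transition system (WTS) is a triple $\mathcal{M}=(S,\rightarrow,\ell)$ where $S$ is a non-empty set of states, $\rightarrow\subseteq S\times\mathbb{R}_{\ge 0}\times S$ is a transition relation (write $s\xrightarrow{r}t$), and $\ell:S\to 2^{\mathcal{AP}}$ is a labeling. For $s\in S$, $T\subseteq S$ let $\theta(s)(T)=\{r\mid \exists t\in T,\ s\xrightarrow{r}t\}$; $\theta^-(s)(T)=-\infty$ if $\theta(s)(T)=\emptyset$, else $\inf\theta(s)(T)$; $\theta^+(s)(T)=\infty$ if $\theta(s)(T)=\emptyset$, else $\sup\theta(s)(T)$. Formulae of $\mathcal{L}$: $\varphi::= p\mid\neg\varphi\mid\varphi\wedge\varphi\mid L_r\varphi\mid M_r\varphi$ with $p\in\mathcal{AP}$, $r\in\mathbb{Q}_{\ge0}$. Semantics: $\mathcal{M},s\models p$ iff $p\in\ell(s)$; Boolean cases as usual; $\mathcal{M},s\models L_r\varphi$ iff $\theta^-(s)([\![\varphi]\!])\ge r$; $\mathcal{M},s\models M_r\varphi$ iff $\theta^+(s)([\![\varphi]\!])\le r$, where $[\![\varphi]\!]=\{s\in S\mid\mathcal{M},s\models\varphi\}$. *)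

theory Defs
  imports Complex_Main "HOL-Library.Extended_Real" "HOL-Library.Nat_Bijection"
begin

subsection \<open>Weighted transition systems\<close>

record ('s, 'ap) wts =
  states :: "'s set"
  trans :: "('s \<times> real \<times> 's) set"
  label :: "'s \<Rightarrow> 'ap set"

definition is_wts :: "('s, 'ap) wts \<Rightarrow> bool" where
  "is_wts M \<longleftrightarrow> states M \<noteq> {} \<and> trans M \<subseteq> states M \<times> {0..} \<times> states M"

definition theta :: "('s, 'ap) wts \<Rightarrow> 's \<Rightarrow> 's set \<Rightarrow> real set" where
  "theta M s T = {r. \<exists>t\<in>T. (s, r, t) \<in> trans M}"

definition theta_minus :: "('s, 'ap) wts \<Rightarrow> 's \<Rightarrow> 's set \<Rightarrow> ereal" where
  "theta_minus M s T = (if theta M s T = {} then - \<infinity> else Inf (ereal ` theta M s T))"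

definition theta_plus :: "('s, 'ap) wts \<Rightarrow> 's \<Rightarrow> 's set \<Rightarrow> ereal" where
  "theta_plus M s T = (if theta M s T = {} then \<infinity> else Sup (ereal ` theta M s T))"

subsection \<open>The logic\<close>

typedef nnrat = "{q :: rat. 0 \<le> q}"
  morphisms rat_of_nnrat nnrat_of_rat
  by auto

datatype 'ap form =
    Atom 'ap
  | Neg "'ap form"
  | And "'ap form" "'ap form"
  | Lower nnrat "'ap form"  \<comment> \<open>\<open>L\<^sub>r \<phi>\<close>\<close>
  | Upper nnrat "'ap form"  \<comment> \<open>\<open>M\<^sub>r \<phi>\<close>\<close>

primrec models :: "('s, 'ap) wts \<Rightarrow> 's \<Rightarrow> 'ap form \<Rightarrow> bool" where
  "models M s (Atom p) \<longleftrightarrow> p \<in> label M s"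
| "models M s (Neg \<phi>) \<longleftrightarrow> \<not> models M s \<phi>"
| "models M s (And \<phi> \<psi>) \<longleftrightarrow> models M s \<phi> \<and> models M s \<psi>"
| "models M s (Lower r \<phi>) \<longleftrightarrow>
     theta_minus M s {t \<in> states M. models M t \<phi>} \<ge> ereal (real_of_rat (rat_of_nnrat r))"
| "models M s (Upper r \<phi>) \<longleftrightarrow>
     theta_plus M s {t \<in> states M. models M t \<phi>} \<le> ereal (real_of_rat (rat_of_nnrat r))"

text \<open>
  HOL cannot quantify over types inside a formula, so satisfiability is relative to the type from
  which the states are drawn. The set of states is an arbitrary non-empty subset of that type. To cover
  all transition systems, a statement about satisfiability over \<open>nat\<close> has to be accompanied by
  one saying that, for an arbitrary type variable \<open>'s\<close>, satisfiability over \<open>'s\<close> implies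
  satisfiability over \<open>nat\<close>.
\<close>

definition satisfiable :: "'s itself \<Rightarrow> 'ap form \<Rightarrow> bool" where
  "satisfiable (_ :: 's itself) \<phi> \<longleftrightarrow>
     (\<exists>M :: ('s, 'ap) wts. is_wts M \<and> (\<exists>s \<in> states M. models M s \<phi>))"

subsection \<open>Decidability\<close>

text \<open>
  \<open>total_recursive n f\<close>: the total function \<open>f\<close>, applied to lists of length \<open>n\<close>, is a general
  recursive function of \<open>n\<close> arguments, in Kleene's presentation. Minimisation is applied to
  regular functions only, which yields exactly the total computable functions. The values of
  \<open>f\<close> on lists of other lengths are irrelevant.
\<close>

inductive total_recursive :: "nat \<Rightarrow> (nat list \<Rightarrow> nat) \<Rightarrow> bool" where
  zero: "total_recursive n (\<lambda>_. 0)"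
| succ: "total_recursive 1 (\<lambda>xs. Suc (hd xs))"
| proj: "i < n \<Longrightarrow> total_recursive n (\<lambda>xs. xs ! i)"
| comp: "total_recursive (length gs) f \<Longrightarrow> \<forall>g \<in> set gs. total_recursive n g
    \<Longrightarrow> total_recursive n (\<lambda>xs. f (map (\<lambda>g. g xs) gs))"
| prec: "total_recursive n f \<Longrightarrow> total_recursive (n + 2) g
    \<Longrightarrow> total_recursive (n + 1)
          (\<lambda>xs. rec_nat (f (tl xs)) (\<lambda>k r. g (k # r # tl xs)) (hd xs))"
| mini: "total_recursive (n + 1) f \<Longrightarrow> \<forall>xs. length xs = n \<longrightarrow> (\<exists>y. f (y # xs) = 0)
    \<Longrightarrow> total_recursive n (\<lambda>xs. LEAST y. f (y # xs) = 0)"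

text \<open>
  The inputs are the codes of elements of \<open>'a\<close>; nothing is required of the answers given on
  numbers that code no element.
\<close>

definition decidable :: "('a \<Rightarrow> nat) \<Rightarrow> 'a set \<Rightarrow> bool" where
  "decidable code A \<longleftrightarrow>
     (\<exists>f. total_recursive 1 f \<and> (\<forall>x. f [code x] = (if x \<in> A then 1 else 0)))"

definition nnrat_code :: "nnrat \<Rightarrow> nat" where
  "nnrat_code r = (case quotient_of (rat_of_nnrat r) of (p, q) \<Rightarrow> prod_encode (nat p, nat q))"

text \<open>The parameter \<open>c\<close> numbers the atomic propositions.\<close>

primrec form_code :: "('ap \<Rightarrow> nat) \<Rightarrow> 'ap form \<Rightarrow> nat" where
  "form_code c (Atom p) = prod_encode (0, c p)"
| "form_code c (Neg \<phi>) = prod_encode (1, form_code c \<phi>)"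
| "form_code c (And \<phi> \<psi>) = prod_encode (2, prod_encode (form_code c \<phi>, form_code c \<psi>))"
| "form_code c (Lower r \<phi>) = prod_encode (3, prod_encode (nnrat_code r, form_code c \<phi>))"
| "form_code c (Upper r \<phi>) = prod_encode (4, prod_encode (nnrat_code r, form_code c \<phi>))"

lemma nnrat_code_inject: "nnrat_code r = nnrat_code r' \<longleftrightarrow> r = r'"
proof
  assume eq: "nnrat_code r = nnrat_code r'"
  obtain p q where pq: "quotient_of (rat_of_nnrat r) = (p, q)" by fastforce
  obtain p' q' where pq': "quotient_of (rat_of_nnrat r') = (p', q')" by fastforce
  have q: "0 < q" "0 < q'" using pq pq' quotient_of_denom_pos by blast+
  have "rat_of_nnrat r = of_int p / of_int q" "rat_of_nnrat r' = of_int p' / of_int q'"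
    using pq pq' quotient_of_div by blast+
  with rat_of_nnrat[of r] rat_of_nnrat[of r'] q have "0 \<le> p" "0 \<le> p'"
    by (auto simp: zero_le_divide_iff)
  with eq pq pq' q have "p = p'" "q = q'"
    by (auto simp: nnrat_code_def prod_encode_eq)
  with pq pq' have "rat_of_nnrat r = rat_of_nnrat r'" by (metis quotient_of_inject)
  then show "r = r'" by (simp add: rat_of_nnrat_inject)
qed simp

lemma inj_form_code:
  assumes "inj c"
  shows "inj (form_code c)"
proof (rule injI)
  fix \<phi> \<psi> :: "'a form"
  show "form_code c \<phi> = form_code c \<psi> \<Longrightarrow> \<phi> = \<psi>"
  proof (induction \<phi> arbitrary: \<psi>)
    case (Atom p)
    then show ?case using assms by (cases \<psi>) (auto simp: prod_encode_eq dest: injD)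
  qed (case_tac \<psi>; auto simp: prod_encode_eq nnrat_code_inject)+
qed

end

theory Submission
  imports Defs
begin

text \<open>
  Filtration and Hintikka sets: describe a state by the set of (codes of) formulae below a bound
  that hold in it, where \<open>\<diamond>\<psi>\<close> is added as a formula saying that some transition leads to
  \<open>\<psi>\<close>. The types occurring in a model form a finite saturated set. Conversely, a saturated set
  of types carries a canonical model: the formulae \<open>L\<^sub>r \<psi>\<close> and \<open>M\<^sub>r \<psi>\<close> of a type \<open>t\<close> with \<open>\<psi> \<in> u\<close>
  confine the weights of transitions from \<open>t\<close> to \<open>u\<close> to an interval with finitely many constraints,
  all weights in it are allowed, and \<open>\<not> L\<^sub>r \<psi>\<close> and \<open>\<not> M\<^sub>r \<psi>\<close> are witnessed at an end
  of such an interval. So weights need not be part of a certificate. Types and sets of types are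
  coded as bit sets, which bounds the search for a certificate and leaves only bounded quantifiers,
  and the canonical model lives on the natural numbers.
\<close>

subsection \<open>Computable functions and predicates\<close>

text \<open>
  Arguments are read from an environment, so that a quantifier shifts indices by plain
  beta-reduction; only values on lists of length \<open>n\<close> matter.
\<close>

definition computable :: "nat \<Rightarrow> ((nat \<Rightarrow> nat) \<Rightarrow> nat) \<Rightarrow> bool" where
  "computable n F \<longleftrightarrow>
     (\<exists>g. total_recursive n g \<and> (\<forall>xs. length xs = n \<longrightarrow> g xs = F (\<lambda>i. xs ! i)))"

text \<open>Zero stands for truth, to match minimisation.\<close>

definition decidable_pred :: "nat \<Rightarrow> ((nat \<Rightarrow> nat) \<Rightarrow> bool) \<Rightarrow> bool" where
  "decidable_pred n P \<longleftrightarrow> computable n (\<lambda>e. if P e then 0 else 1)"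

section \<open>Closure under composition, primitive recursion and minimisation\<close>

lemma computable_cong: "computable n F \<Longrightarrow> (\<And>e. F e = G e) \<Longrightarrow> computable n G"
  by (metis ext)

lemma computable_var: "i < n \<Longrightarrow> computable n (\<lambda>e. e i)"
  unfolding computable_def by (blast intro: total_recursive.proj)

text \<open>The environment handed to \<open>F\<close> is again the indexing function of a list, so
  the equation for \<open>f\<close> on that list applies to it literally.\<close>

lemma computable_subst:
  assumes "computable (length gs) F" and gs: "\<And>g. g \<in> set gs \<Longrightarrow> computable n g"
  shows "computable n (\<lambda>e. F (\<lambda>i. map (\<lambda>g. g e) gs ! i))"
proof -
  obtain f where f: "total_recursive (length gs) f"
    "\<And>xs. length xs = length gs \<Longrightarrow> f xs = F (\<lambda>i. xs ! i)"
    using assms(1) by (auto simp: computable_def)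
  have "\<forall>g\<in>set gs. \<exists>h. total_recursive n h \<and> (\<forall>xs. length xs = n \<longrightarrow> h xs = g (\<lambda>i. xs ! i))"
    using gs by (simp add: computable_def)
  then obtain h where h: "\<forall>g\<in>set gs. total_recursive n (h g) \<and>
      (\<forall>xs. length xs = n \<longrightarrow> h g xs = g (\<lambda>i. xs ! i))"
    by metis
  have "total_recursive n (\<lambda>xs. f (map (\<lambda>g. g xs) (map h gs)))"
    by (rule total_recursive.comp) (use f h in auto)
  moreover have "f (map (\<lambda>g. g xs) (map h gs)) = F (\<lambda>i. map (\<lambda>g. g (\<lambda>i. xs ! i)) gs ! i)"
    if "length xs = n" for xs
  proof -
    have "map (\<lambda>g. g xs) (map h gs) = map (\<lambda>g. g (\<lambda>i. xs ! i)) gs"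
      using h that by simp
    then show ?thesis using f(2)[of "map (\<lambda>g. g (\<lambda>i. xs ! i)) gs"] by (simp only: length_map)
  qed
  ultimately show ?thesis unfolding computable_def by blast
qed

lemma computable_subst2:
  assumes "computable 2 (\<lambda>e. F (e 0) (e 1))" "computable n f" "computable n g"
  shows "computable n (\<lambda>e. F (f e) (g e))"
proof -
  have "computable (length [f, g]) (\<lambda>e. F (e 0) (e 1))" using assms(1) by (simp add: numeral_2_eq_2)
  then have "computable n (\<lambda>e. F (map (\<lambda>g. g e) [f, g] ! 0) (map (\<lambda>g. g e) [f, g] ! 1))"
    by (rule computable_subst) (use assms in auto)
  then show ?thesis by simp
qed

lemma computable_subst3:
  assumes "computable 3 (\<lambda>e. F (e 0) (e 1) (e 2))" "computable n f" "computable n g" "computable n h"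
  shows "computable n (\<lambda>e. F (f e) (g e) (h e))"
proof -
  have "computable (length [f, g, h]) (\<lambda>e. F (e 0) (e 1) (e 2))"
    using assms(1) by (simp add: numeral_3_eq_3)
  then have "computable n (\<lambda>e. F (map (\<lambda>g. g e) [f, g, h] ! 0) (map (\<lambda>g. g e) [f, g, h] ! 1)
      (map (\<lambda>g. g e) [f, g, h] ! 2))"
    by (rule computable_subst) (use assms in auto)
  then show ?thesis by simp
qed

lemma computable_Suc:
  assumes "computable n f" shows "computable n (\<lambda>e. Suc (f e))"
proof -
  have "total_recursive 1 (\<lambda>xs. Suc (hd xs))" by (rule total_recursive.succ)
  then have "computable 1 (\<lambda>e. Suc (e 0))"
    unfolding computable_def by (intro exI conjI) (auto simp: length_Suc_conv)
  then have "computable (length [f]) (\<lambda>e. Suc (e 0))" by simp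
  then have "computable n (\<lambda>e. Suc (map (\<lambda>g. g e) [f] ! 0))"
    by (rule computable_subst) (use assms in auto)
  then show ?thesis by simp
qed

lemma computable_const: "computable n (\<lambda>_. k)"
proof (induction k)
  case 0
  then show ?case unfolding computable_def by (blast intro: total_recursive.zero)
qed (rule computable_Suc)

lemma computable_rec_nat:
  assumes "computable n a" "computable n b"
    and "computable (Suc (Suc n)) (\<lambda>e. G (e 0) (e (Suc 0)) (\<lambda>i. e (Suc (Suc i))))"
  shows "computable n (\<lambda>e. rec_nat (a e) (\<lambda>k r. G k r e) (b e))"
proof -
  obtain ga gb gG where ga: "total_recursive n ga" "\<And>xs. length xs = n \<Longrightarrow> ga xs = a (\<lambda>i. xs ! i)"
    and gb: "total_recursive n gb" "\<And>xs. length xs = n \<Longrightarrow> gb xs = b (\<lambda>i. xs ! i)"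
    and gG: "total_recursive (n + 2) gG" "\<And>xs. length xs = n + 2 \<Longrightarrow>
      gG xs = G (xs ! 0) (xs ! Suc 0) (\<lambda>i. xs ! Suc (Suc i))"
    using assms by (auto simp: computable_def)
  \<comment> \<open>Putting the bound in front of the projections turns the schema, which recurses
    on its first argument, into recursion up to \<open>b e\<close>.\<close>
  define gs where "gs = gb # map (\<lambda>i xs. xs ! i) [0..<n]"
  define h where "h = (\<lambda>xs. rec_nat (ga (tl xs)) (\<lambda>k r. gG (k # r # tl xs)) (hd xs))"
  have "total_recursive (length gs) h"
    using total_recursive.prec[OF ga(1) gG(1)] by (simp add: h_def gs_def)
  then have 1: "total_recursive n (\<lambda>xs. h (map (\<lambda>g. g xs) gs))"
    by (rule total_recursive.comp) (auto simp: gs_def gb intro: total_recursive.proj)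
  have "map (\<lambda>g. g xs) gs = b (\<lambda>i. xs ! i) # xs" if "length xs = n" for xs
    using that gb by (auto simp: gs_def comp_def intro: nth_equalityI)
  then have "h (map (\<lambda>g. g xs) gs) =
      rec_nat (a (\<lambda>i. xs ! i)) (\<lambda>k r. G k r (\<lambda>i. xs ! i)) (b (\<lambda>i. xs ! i))"
    if "length xs = n" for xs
    using that by (simp add: h_def ga gG)
  with 1 show ?thesis unfolding computable_def by blast
qed

lemma computable_LEAST_zero:
  assumes "computable (Suc n) (\<lambda>e. F (e 0) (\<lambda>i. e (Suc i)))" and ex: "\<And>e. \<exists>y. F y e = 0"
  shows "computable n (\<lambda>e. LEAST y. F y e = 0)"
proof -
  obtain g where g: "total_recursive (n + 1) g" "\<And>xs. length xs = Suc n \<Longrightarrow>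
      g xs = F (xs ! 0) (\<lambda>i. xs ! Suc i)"
    using assms by (auto simp: computable_def)
  have eq: "g (y # xs) = F y (\<lambda>i. xs ! i)" if "length xs = n" for xs y
    using g(2)[of "y # xs"] that by simp
  have "total_recursive n (\<lambda>xs. LEAST y. g (y # xs) = 0)"
    by (rule total_recursive.mini[OF g(1)]) (auto simp: eq ex)
  then show ?thesis
    unfolding computable_def by (intro exI conjI) (auto simp: eq)
qed

lemma computable_LEAST:
  assumes "decidable_pred (Suc n) (\<lambda>e. P (e 0) (\<lambda>i. e (Suc i)))" and ex: "\<And>e. \<exists>y. P y e"
  shows "computable n (\<lambda>e. LEAST y. P y e)"
proof -
  \<comment> \<open>The characteristic function of \<open>P\<close> vanishes exactly where
    \<open>P\<close> holds, so minimising it finds the least witness.\<close>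
  have "computable n (\<lambda>e. LEAST y. (if P y e then 0 else 1) = (0::nat))"
    using assms by (intro computable_LEAST_zero) (auto simp: decidable_pred_def)
  then show ?thesis by (rule computable_cong) (auto intro: arg_cong[where f = Least])
qed

section \<open>Arithmetic and case distinction\<close>

lemma computable_add:
  assumes "computable n f" "computable n g" shows "computable n (\<lambda>e. f e + g e)"
proof -
  have eq: "a + b = rec_nat a (\<lambda>k r. Suc r) b" for a b :: nat by (induction b) auto
  show ?thesis unfolding eq
    by (intro computable_rec_nat assms computable_Suc computable_var) simp
qed

text \<open>Weakening under a binder, obtained by composing with the projections that skip the first
  argument.\<close>

lemma computable_shift:
  assumes "computable n f"
  shows "computable (Suc n) (\<lambda>e. f (\<lambda>i. e (Suc i)))"
proof -
  obtain g where g: "total_recursive n g" "\<And>xs. length xs = n \<Longrightarrow> g xs = f (\<lambda>i. xs ! i)"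
    using assms by (auto simp: computable_def)
  define gs :: "(nat list \<Rightarrow> nat) list" where "gs = map (\<lambda>i xs. xs ! Suc i) [0..<n]"
  have 1: "total_recursive (Suc n) (\<lambda>xs. g (map (\<lambda>h. h xs) gs))"
    by (rule total_recursive.comp) (auto simp: gs_def g intro: total_recursive.proj)
  have "g (map (\<lambda>h. h xs) gs) = f (\<lambda>i. xs ! Suc i)" if "length xs = Suc n" for xs
  proof -
    obtain y ys where xs: "xs = y # ys" "length ys = n"
      using \<open>length xs = Suc n\<close> by (auto simp: length_Suc_conv)
    then have "map (\<lambda>h. h xs) gs = ys"
      by (auto simp: gs_def comp_def intro: nth_equalityI)
    then show ?thesis using xs g by simp
  qed
  with 1 show ?thesis unfolding computable_def by blast
qed

lemma computable_if_zero:
  assumes "computable n f" "computable n g" "computable n h"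
  shows "computable n (\<lambda>e. if f e = 0 then g e else h e)"
proof -
  \<comment> \<open>A recursion whose step ignores its arguments chooses between the base value and
    \<open>b\<close>.\<close>
  have eq: "(if k = 0 then a else b) = rec_nat a (\<lambda>_ _. b) k" for k and a b :: nat
    by (cases k) auto
  show ?thesis unfolding eq
    by (intro computable_rec_nat assms assms[THEN computable_shift, THEN computable_shift])
qed

lemma computable_mult:
  assumes "computable n f" "computable n g" shows "computable n (\<lambda>e. f e * g e)"
proof -
  have eq: "a * b = rec_nat 0 (\<lambda>k r. r + a) b" for a b :: nat by (induction b) auto
  show ?thesis unfolding eq
    by (intro computable_rec_nat assms computable_add computable_const computable_var
        assms[THEN computable_shift, THEN computable_shift]) simp
qed

lemma computable_power:
  assumes "computable n f" "computable n g" shows "computable n (\<lambda>e. f e ^ g e)"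
proof -
  have eq: "a ^ b = rec_nat 1 (\<lambda>k r. r * a) b" for a b :: nat by (induction b) auto
  show ?thesis unfolding eq
    by (intro computable_rec_nat assms computable_mult computable_const computable_var
        assms[THEN computable_shift, THEN computable_shift]) simp
qed

lemma computable_diff:
  assumes "computable n f" "computable n g" shows "computable n (\<lambda>e. f e - g e)"
proof -
  \<comment> \<open>The predecessor is the recursion that returns its counter; iterating it gives
    truncated subtraction.\<close>
  have pred: "rec_nat 0 (\<lambda>k _. k) a = a - Suc 0" for a :: nat by (cases a) auto
  have eq: "rec_nat a (\<lambda>_ r. rec_nat 0 (\<lambda>k _. k) r) b = a - b" for a b :: nat
    by (induction b) (auto simp: pred)
  have "computable n (\<lambda>e. rec_nat (f e) (\<lambda>_ r. rec_nat 0 (\<lambda>k _. k) r) (g e))"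
    by (intro computable_rec_nat assms computable_const computable_var) simp_all
  then show ?thesis unfolding eq .
qed

section \<open>Connectives and bounded quantifiers\<close>

lemma decidable_pred_eq_zero:
  assumes "computable n f" shows "decidable_pred n (\<lambda>e. f e = 0)"
  unfolding decidable_pred_def by (intro computable_if_zero assms computable_const)

lemma computable_if:
  assumes "decidable_pred n P" "computable n g" "computable n h"
  shows "computable n (\<lambda>e. if P e then g e else h e)"
proof -
  have "computable n (\<lambda>e. if (if P e then 0 else 1) = (0::nat) then g e else h e)"
    using assms unfolding decidable_pred_def by (intro computable_if_zero)
  then show ?thesis by (rule computable_cong) simp
qed

lemma decidable_pred_not:
  assumes "decidable_pred n P" shows "decidable_pred n (\<lambda>e. \<not> P e)"
proof -
  have "computable n (\<lambda>e. if P e then 1 else 0)"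
    by (intro computable_if assms computable_const)
  then show ?thesis unfolding decidable_pred_def by (rule computable_cong) simp
qed

lemma decidable_pred_conj:
  assumes "decidable_pred n P" "decidable_pred n Q" shows "decidable_pred n (\<lambda>e. P e \<and> Q e)"
proof -
  have "computable n (\<lambda>e. if P e then if Q e then 0 else 1 else 1)"
    by (intro computable_if assms computable_const)
  then show ?thesis unfolding decidable_pred_def by (rule computable_cong) simp
qed

lemma decidable_pred_disj:
  assumes "decidable_pred n P" "decidable_pred n Q" shows "decidable_pred n (\<lambda>e. P e \<or> Q e)"
  using decidable_pred_not[OF decidable_pred_conj[OF assms[THEN decidable_pred_not]]] by simp

lemma decidable_pred_imp:
  assumes "decidable_pred n P" "decidable_pred n Q" shows "decidable_pred n (\<lambda>e. P e \<longrightarrow> Q e)"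
  unfolding imp_conv_disj by (intro decidable_pred_disj decidable_pred_not assms)

lemma decidable_pred_iff:
  assumes "decidable_pred n P" "decidable_pred n Q" shows "decidable_pred n (\<lambda>e. P e \<longleftrightarrow> Q e)"
  unfolding iff_conv_conj_imp by (intro decidable_pred_conj decidable_pred_imp assms)

lemma decidable_pred_le:
  assumes "computable n f" "computable n g" shows "decidable_pred n (\<lambda>e. f e \<le> g e)"
  using decidable_pred_eq_zero[OF computable_diff[OF assms]] by simp

lemma decidable_pred_less:
  assumes "computable n f" "computable n g" shows "decidable_pred n (\<lambda>e. f e < g e)"
  using decidable_pred_le[OF computable_Suc[OF assms(1)] assms(2)] by (simp add: Suc_le_eq)

lemma decidable_pred_eq:
  assumes "computable n f" "computable n g" shows "decidable_pred n (\<lambda>e. f e = g e)"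
  unfolding order_eq_iff by (intro decidable_pred_conj decidable_pred_le assms)

text \<open>The search for a witness is stopped at the bound, so it always terminates; a witness
  below the bound exists exactly when it stops earlier.\<close>

lemma decidable_pred_bex:
  assumes "computable n b" "decidable_pred (Suc n) (\<lambda>e. P (e 0) (\<lambda>i. e (Suc i)))"
  shows "decidable_pred n (\<lambda>e. \<exists>y<b e. P y e)"
proof -
  define m where "m = (\<lambda>e. LEAST y. b e \<le> y \<or> P y e)"
  have "computable n m" unfolding m_def
    by (intro computable_LEAST decidable_pred_disj decidable_pred_le assms(2)
        computable_shift[OF assms(1)] computable_var) auto
  then have "decidable_pred n (\<lambda>e. m e < b e)"
    by (intro decidable_pred_less assms)
  moreover have "m e < b e \<longleftrightarrow> (\<exists>y<b e. P y e)" for e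
  proof
    have "b e \<le> m e \<or> P (m e) e" unfolding m_def by (rule LeastI[of _ "b e"]) simp
    then show "\<exists>y<b e. P y e" if "m e < b e" using that by auto
    show "m e < b e" if "\<exists>y<b e. P y e"
      using that unfolding m_def by (auto intro: order.strict_trans1[OF Least_le])
  qed
  ultimately show ?thesis by simp
qed

lemma decidable_pred_ball:
  assumes "computable n b" "decidable_pred (Suc n) (\<lambda>e. P (e 0) (\<lambda>i. e (Suc i)))"
  shows "decidable_pred n (\<lambda>e. \<forall>y<b e. P y e)"
  using decidable_pred_not[OF decidable_pred_bex[OF assms(1) decidable_pred_not[OF assms(2)]]]
  by simp

lemmas computable_basic =
  computable_var computable_const computable_Suc computable_add computable_mult computable_power
  decidable_pred_not decidable_pred_conj decidable_pred_disj decidable_pred_imp decidable_pred_iff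
  decidable_pred_le decidable_pred_less decidable_pred_eq decidable_pred_bex decidable_pred_ball
  computable_if

section \<open>Division, pairing and membership in bit sets\<close>

lemma computable_div:
  assumes "computable n f" "computable n g" shows "computable n (\<lambda>e. f e div g e)"
proof -
  \<comment> \<open>The disjunct \<open>b = 0\<close> stops the search at once with
    \<open>0\<close>, in agreement with division by zero, and keeps it total.\<close>
  have eq: "a div b = (LEAST q. b = 0 \<or> a < Suc q * b)" for a b :: nat
  proof (rule Least_equality[symmetric])
    show "b = 0 \<or> a < Suc (a div b) * b"
      by (metis add.commute div_less_iff_less_mult lessI neq0_conv)
    show "a div b \<le> q" if "b = 0 \<or> a < Suc q * b" for q
      using that by (metis div_by_0 div_less_iff_less_mult less_Suc_eq_le neq0_conv zero_le)
  qed
  show ?thesis unfolding eq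
  proof (intro computable_LEAST computable_basic assms[THEN computable_shift] assms)
    show "\<exists>y. g e = 0 \<or> f e < Suc y * g e" for e
      by (rule exI[of _ "f e"]) (cases "g e"; simp)
  qed auto
qed

lemma computable_prod_encode:
  assumes "computable n f" "computable n g" shows "computable n (\<lambda>e. prod_encode (f e, g e))"
  unfolding prod_encode_def triangle_def prod.case
  by (intro computable_basic computable_div assms)

text \<open>Both components of a pair are at most its code: one is searched for, the other is
  confined below \<open>Suc x\<close>.\<close>

lemma computable_fst_prod_decode:
  assumes "computable n f" shows "computable n (\<lambda>e. fst (prod_decode (f e)))"
proof -
  have enc: "\<exists>z<Suc x. prod_encode (fst (prod_decode x), z) = x" for x
    by (rule exI[of _ "snd (prod_decode x)"])
      (metis le_prod_encode_2 less_Suc_eq_le prod.collapse prod_decode_inverse)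
  have eq: "fst (prod_decode x) = (LEAST y. \<exists>z<Suc x. prod_encode (y, z) = x)" for x
    by (rule Least_equality[symmetric]) (use enc in auto)
  show ?thesis unfolding eq
    by (intro computable_LEAST computable_basic computable_prod_encode assms[THEN computable_shift]
        assms[THEN computable_shift, THEN computable_shift] assms) (use enc in blast)+
qed

lemma computable_snd_prod_decode:
  assumes "computable n f" shows "computable n (\<lambda>e. snd (prod_decode (f e)))"
proof -
  have enc: "\<exists>z<Suc x. prod_encode (z, snd (prod_decode x)) = x" for x
    by (rule exI[of _ "fst (prod_decode x)"])
      (metis le_prod_encode_1 less_Suc_eq_le prod.collapse prod_decode_inverse)
  have eq: "snd (prod_decode x) = (LEAST y. \<exists>z<Suc x. prod_encode (z, y) = x)" for x
    by (rule Least_equality[symmetric]) (use enc in auto)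
  show ?thesis unfolding eq
    by (intro computable_LEAST computable_basic computable_prod_encode assms[THEN computable_shift]
        assms[THEN computable_shift, THEN computable_shift] assms) (use enc in blast)+
qed

lemma decidable_pred_set_decode:
  assumes "computable n f" "computable n g" shows "decidable_pred n (\<lambda>e. f e \<in> set_decode (g e))"
proof -
  have odd: "odd k \<longleftrightarrow> k \<noteq> 2 * (k div 2)" for k :: nat by presburger
  show ?thesis unfolding set_decode_def mem_Collect_eq odd
    by (intro computable_basic computable_div assms)
qed


subsection \<open>Codes and their meaning\<close>

text \<open>Division by zero makes this total on numbers that code no rational; in particular
  \<open>weight 0 = 0\<close> because \<open>0\<close> codes \<open>(0, 0)\<close>.\<close>

definition weight :: "nat \<Rightarrow> real" where
  "weight c = real (fst (prod_decode c)) / real (snd (prod_decode c))"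

lemma weight_nonneg: "0 \<le> weight c"
  by (simp add: weight_def)

lemma weight_0: "weight 0 = 0"
  by (simp add: weight_def prod_decode_def prod_decode_aux.simps)

lemma weight_nnrat_code: "weight (nnrat_code r) = real_of_rat (rat_of_nnrat r)"
proof -
  obtain p q where pq: "quotient_of (rat_of_nnrat r) = (p, q)" by fastforce
  then have q: "0 < q" by (rule quotient_of_denom_pos)
  have r: "rat_of_nnrat r = of_int p / of_int q" using pq by (rule quotient_of_div)
  with rat_of_nnrat[of r] q have "0 \<le> p" by (auto simp: zero_le_divide_iff)
  with q pq show ?thesis by (simp add: weight_def nnrat_code_def r of_rat_divide)
qed

lemma decidable_pred_weight_le:
  assumes "computable n f" "computable n g"
  shows "decidable_pred n (\<lambda>e. weight (f e) \<le> weight (g e))"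
proof -
  \<comment> \<open>Cross-multiplication, with the zero denominators split off: a code with
    denominator \<open>0\<close> has weight \<open>0\<close>, so on the left it makes the comparison
    true, and on the right it leaves only weight \<open>0\<close> below it.\<close>
  have eq: "weight c \<le> weight d \<longleftrightarrow>
      snd (prod_decode c) = 0 \<or> fst (prod_decode c) = 0 \<or> snd (prod_decode d) \<noteq> 0 \<and>
      fst (prod_decode c) * snd (prod_decode d) \<le> fst (prod_decode d) * snd (prod_decode c)" for c d
  proof (cases "snd (prod_decode c) = 0 \<or> snd (prod_decode d) = 0")
    case False
    then have "weight c \<le> weight d \<longleftrightarrow>
        real (fst (prod_decode c) * snd (prod_decode d)) \<le> real (fst (prod_decode d) * snd (prod_decode c))"
      by (simp add: weight_def field_simps)
    then show ?thesis using False by (simp only: of_nat_le_iff) auto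
  qed (auto simp: weight_def divide_le_0_iff)
  show ?thesis unfolding eq
    by (intro computable_basic computable_fst_prod_decode computable_snd_prod_decode assms)
qed

text \<open>The value \<open>- \<infinity>\<close> on the empty set fails every rational bound,
  hence the existence of a transition; otherwise an infimum is at least \<open>r\<close> iff every
  element is. Targets of transitions are states, so the restriction to \<open>states M\<close>
  disappears.\<close>

lemma models_Lower_iff:
  assumes "is_wts M"
  shows "models M s (Lower r \<phi>) \<longleftrightarrow> (\<exists>w t. (s, w, t) \<in> trans M \<and> models M t \<phi>) \<and>
    (\<forall>w t. (s, w, t) \<in> trans M \<longrightarrow> models M t \<phi> \<longrightarrow> weight (nnrat_code r) \<le> w)"
proof -
  have "theta M s {t \<in> states M. models M t \<phi>} = {w. \<exists>t. (s, w, t) \<in> trans M \<and> models M t \<phi>}"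
    using assms by (auto simp: theta_def is_wts_def)
  then show ?thesis by (auto simp: theta_minus_def weight_nnrat_code le_Inf_iff)
qed

text \<open>Dually, the value \<open>\<infinity>\<close> on the empty set exceeds every rational
  bound.\<close>

lemma models_Upper_iff:
  assumes "is_wts M"
  shows "models M s (Upper r \<phi>) \<longleftrightarrow> (\<exists>w t. (s, w, t) \<in> trans M \<and> models M t \<phi>) \<and>
    (\<forall>w t. (s, w, t) \<in> trans M \<longrightarrow> models M t \<phi> \<longrightarrow> w \<le> weight (nnrat_code r))"
proof -
  have "theta M s {t \<in> states M. models M t \<phi>} = {w. \<exists>t. (s, w, t) \<in> trans M \<and> models M t \<phi>}"
    using assms by (auto simp: theta_def is_wts_def)
  then show ?thesis by (auto simp: theta_plus_def weight_nnrat_code Sup_le_iff)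
qed

abbreviation neg_code :: "nat \<Rightarrow> nat" where
  "neg_code y \<equiv> prod_encode (1, y)"
abbreviation and_code :: "nat \<Rightarrow> nat \<Rightarrow> nat" where
  "and_code y z \<equiv> prod_encode (2, prod_encode (y, z))"
abbreviation lower_code :: "nat \<Rightarrow> nat \<Rightarrow> nat" where
  "lower_code c y \<equiv> prod_encode (3, prod_encode (c, y))"
abbreviation upper_code :: "nat \<Rightarrow> nat \<Rightarrow> nat" where
  "upper_code c y \<equiv> prod_encode (4, prod_encode (c, y))"
text \<open>The tag \<open>5\<close> is not used by \<open>form_code\<close>.\<close>

abbreviation dia_code :: "nat \<Rightarrow> nat" where
  "dia_code y \<equiv> prod_encode (5, y)"

section \<open>Size estimates for pair codes\<close>

lemma strict_mono_triangle: "m < n \<Longrightarrow> triangle m < triangle n"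
  by (rule lift_Suc_mono_less[of triangle]) auto

lemma prod_encode_strict_mono: "k \<le> l \<Longrightarrow> m < n \<Longrightarrow> prod_encode (k, m) < prod_encode (l, n)"
  using strict_mono_triangle[of "k + m" "l + n"] by (simp add: prod_encode_def)

text \<open>A positive tag moves the pair to a later diagonal than \<open>triangle y\<close>, which
  is already at least \<open>y\<close>.\<close>

lemma less_prod_encode: "0 < k \<Longrightarrow> y < prod_encode (k, y)"
  using le_prod_encode_2[of y 0] strict_mono_triangle[of y "k + y"] by (simp add: prod_encode_def)

lemma less_prod_encode_nested:
  assumes "0 < k"
  shows "y < prod_encode (k, prod_encode (y, z))" "z < prod_encode (k, prod_encode (y, z))"
  using less_prod_encode[OF assms, of "prod_encode (y, z)"] le_prod_encode_1[of y z] le_prod_encode_2[of z y]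
  by linarith+

text \<open>Recursion on a decoded number happens only under a positive tag and therefore descends;
  this gives termination of \<open>denotation\<close>.\<close>

lemma prod_decode_less:
  assumes "0 < fst (prod_decode y)"
  shows "snd (prod_decode y) < y"
    "fst (prod_decode (snd (prod_decode y))) < y" "snd (prod_decode (snd (prod_decode y))) < y"
  using less_prod_encode[OF assms, of "snd (prod_decode y)"]
    less_prod_encode_nested[OF assms, where y = "fst (prod_decode (snd (prod_decode y)))"
      and z = "snd (prod_decode (snd (prod_decode y)))"]
  by simp_all

text \<open>Every number is given a meaning, so that codes of no formula need no special treatment.\<close>

function denotation :: "('ap \<Rightarrow> nat) \<Rightarrow> ('s, 'ap) wts \<Rightarrow> nat \<Rightarrow> 's set" where
  "denotation c M y = (let k = fst (prod_decode y); a = snd (prod_decode y) in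
     if k = 0 then {s. a \<in> c ` label M s}
     else if k = 1 then - denotation c M a
     else if k = 2 then denotation c M (fst (prod_decode a)) \<inter> denotation c M (snd (prod_decode a))
     else if k = 3 then
       {s. (\<exists>w. \<exists>t\<in>denotation c M (snd (prod_decode a)). (s, w, t) \<in> trans M) \<and>
         (\<forall>w. \<forall>t\<in>denotation c M (snd (prod_decode a)). (s, w, t) \<in> trans M \<longrightarrow> weight (fst (prod_decode a)) \<le> w)}
     else if k = 4 then
       {s. (\<exists>w. \<exists>t\<in>denotation c M (snd (prod_decode a)). (s, w, t) \<in> trans M) \<and>
         (\<forall>w. \<forall>t\<in>denotation c M (snd (prod_decode a)). (s, w, t) \<in> trans M \<longrightarrow> w \<le> weight (fst (prod_decode a)))}
     else {s. \<exists>w. \<exists>t\<in>denotation c M a. (s, w, t) \<in> trans M})"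
  by auto
termination
  by (relation "measure (\<lambda>(c, M, y). y)")
    (auto intro: prod_decode_less)

declare denotation.simps [simp del]

lemma denotation_code:
  "denotation c M (prod_encode (0, a)) = {s. a \<in> c ` label M s}"
  "denotation c M (neg_code y) = - denotation c M y"
  "denotation c M (and_code y z) = denotation c M y \<inter> denotation c M z"
  "denotation c M (lower_code d y) =
     {s. (\<exists>w. \<exists>t\<in>denotation c M y. (s, w, t) \<in> trans M) \<and>
       (\<forall>w. \<forall>t\<in>denotation c M y. (s, w, t) \<in> trans M \<longrightarrow> weight d \<le> w)}"
  "denotation c M (upper_code d y) =
     {s. (\<exists>w. \<exists>t\<in>denotation c M y. (s, w, t) \<in> trans M) \<and>
       (\<forall>w. \<forall>t\<in>denotation c M y. (s, w, t) \<in> trans M \<longrightarrow> w \<le> weight d)}"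
  "denotation c M (dia_code y) = {s. \<exists>w. \<exists>t\<in>denotation c M y. (s, w, t) \<in> trans M}"
  by (subst denotation.simps; simp add: Let_def)+

text \<open>Injectivity of \<open>c\<close> lets an atom be recognised by its number in the image of
  a label.\<close>

lemma denotation_form_code:
  assumes "is_wts M" "inj c"
  shows "s \<in> denotation c M (form_code c \<phi>) \<longleftrightarrow> models M s \<phi>"
  using assms
  by (induction \<phi> arbitrary: s)
    (auto simp: denotation_code models_Lower_iff models_Upper_iff inj_image_mem_iff
      simp del: models.simps(4,5) One_nat_def)

subsection \<open>Saturated sets of types\<close>

text \<open>Some weight is allowed for transitions from the type \<open>t\<close> to the type \<open>u\<close>.\<close>

definition compatible :: "nat \<Rightarrow> nat \<Rightarrow> nat \<Rightarrow> bool" where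
  "compatible b t u \<longleftrightarrow>
     (\<forall>y<b. y \<in> set_decode u \<longrightarrow> dia_code y \<in> set_decode t) \<and>
     (\<forall>c<b. \<forall>y<b. \<forall>d<b. \<forall>z<b.
        lower_code c y \<in> set_decode t \<and> y \<in> set_decode u \<and>
        upper_code d z \<in> set_decode t \<and> z \<in> set_decode u \<longrightarrow> weight c \<le> weight d)"

text \<open>The clause for diamonds has its converse in \<open>compatible\<close>. A refuted lower
  bound on an existing transition must be positive, since weights are nonnegative; this and the
  strict inequalities are negations of \<open>\<le>\<close>, the comparison of weights shown
  decidable.\<close>

definition saturated :: "nat \<Rightarrow> nat \<Rightarrow> bool" where
  "saturated b W \<longleftrightarrow> (\<forall>t<W. t \<in> set_decode W \<longrightarrow>
     (\<forall>y<b. neg_code y \<in> set_decode t \<longleftrightarrow> y \<notin> set_decode t) \<and>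
     (\<forall>y<b. \<forall>z<b. and_code y z \<in> set_decode t \<longleftrightarrow> y \<in> set_decode t \<and> z \<in> set_decode t) \<and>
     (\<forall>y<b. dia_code y \<in> set_decode t \<longrightarrow>
        (\<exists>u<W. u \<in> set_decode W \<and> y \<in> set_decode u \<and> compatible b t u)) \<and>
     (\<forall>c<b. \<forall>y<b. lower_code c y \<in> set_decode t \<longrightarrow> dia_code y \<in> set_decode t) \<and>
     (\<forall>c<b. \<forall>y<b. upper_code c y \<in> set_decode t \<longrightarrow> dia_code y \<in> set_decode t) \<and>
     (\<forall>c<b. \<forall>y<b. lower_code c y \<notin> set_decode t \<and> dia_code y \<in> set_decode t \<longrightarrow>
        \<not> weight c \<le> weight 0 \<and>
        (\<exists>u<W. u \<in> set_decode W \<and> y \<in> set_decode u \<and> compatible b t u \<and>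
          (\<forall>d<b. \<forall>z<b. lower_code d z \<in> set_decode t \<and> z \<in> set_decode u \<longrightarrow>
             \<not> weight c \<le> weight d))) \<and>
     (\<forall>c<b. \<forall>y<b. upper_code c y \<notin> set_decode t \<and> dia_code y \<in> set_decode t \<longrightarrow>
        (\<exists>u<W. u \<in> set_decode W \<and> y \<in> set_decode u \<and> compatible b t u \<and>
          (\<forall>d<b. \<forall>z<b. upper_code d z \<in> set_decode t \<and> z \<in> set_decode u \<longrightarrow>
             \<not> weight d \<le> weight c))))"

text \<open>\<open>5\<close> is the largest tag, so by monotonicity of pairing this exceeds every
  code built by one connective from arguments below \<open>b\<close>.\<close>

definition code_bound :: "nat \<Rightarrow> nat" where
  "code_bound b = prod_encode (5, prod_encode (b, b))"

text \<open>A type is a bit set of codes below the bound, hence less than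
  \<open>2 ^ code_bound (Suc x)\<close>; a set of such types costs a second exponential.
  \<open>Suc x\<close> is taken so that \<open>x\<close> itself lies below the bound.\<close>

definition accepted :: "nat \<Rightarrow> bool" where
  "accepted x \<longleftrightarrow> (\<exists>W<2 ^ 2 ^ code_bound (Suc x). saturated (Suc x) W \<and>
     (\<exists>t<W. t \<in> set_decode W \<and> x \<in> set_decode t))"

text \<open>Shown first for three variables, so that passing under quantifiers only shifts indices;
  arbitrary arguments are substituted afterwards.\<close>

lemma decidable_pred_compatible:
  assumes "computable n f" "computable n g" "computable n h"
  shows "decidable_pred n (\<lambda>e. compatible (f e) (g e) (h e))"
proof -
  have "decidable_pred 3 (\<lambda>e. compatible (e 0) (e 1) (e 2))"
    unfolding compatible_def
    by (intro computable_basic computable_prod_encode decidable_pred_set_decode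
        decidable_pred_weight_le; simp)
  then show ?thesis unfolding decidable_pred_def by (rule computable_subst3) (rule assms)+
qed

lemma decidable_pred_saturated:
  assumes "computable n f" "computable n g"
  shows "decidable_pred n (\<lambda>e. saturated (f e) (g e))"
proof -
  have "decidable_pred 2 (\<lambda>e. saturated (e 0) (e 1))"
    unfolding saturated_def
    by (intro computable_basic computable_prod_encode decidable_pred_set_decode
        decidable_pred_weight_le decidable_pred_compatible; simp)
  then show ?thesis unfolding decidable_pred_def by (rule computable_subst2) (rule assms)+
qed

lemma decidable_pred_accepted: "decidable_pred 1 (\<lambda>e. accepted (e 0))"
  unfolding accepted_def code_bound_def
  by (intro computable_basic computable_prod_encode decidable_pred_set_decode
      decidable_pred_saturated; simp)

subsection \<open>The canonical model of a saturated set\<close>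

text \<open>A bit set containing \<open>t\<close> has code at least \<open>2 ^ t\<close>. Hence the
  bounds \<open>t<W\<close> and \<open>u<W\<close> in \<open>saturated\<close> exclude no member of
  \<open>W\<close>.\<close>

lemma less_if_mem_set_decode:
  assumes "t \<in> set_decode W" shows "t < W"
proof -
  have "set_decode (2 ^ t) = {t}"
    using set_encode_inverse[of "{t}"] by (simp add: set_encode_def)
  then have "2 ^ t \<le> W" using assms by (intro subset_decode_imp_le) simp
  then show ?thesis using less_exp[of t] by linarith
qed

lemma set_encode_less:
  assumes "A \<subseteq> {..<n}" shows "set_encode A < 2 ^ n"
proof -
  have "set_encode A \<le> (\<Sum>i<n. 2 ^ i)"
    unfolding set_encode_def by (rule sum_mono2) (use assms in auto)
  also have "\<dots> < 2 ^ n" by (induction n) auto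
  finally show ?thesis .
qed

section \<open>Intervals of allowed transition weights\<close>

definition admissible :: "nat \<Rightarrow> nat \<Rightarrow> nat \<Rightarrow> real \<Rightarrow> bool" where
  "admissible b t u w \<longleftrightarrow> 0 \<le> w \<and>
     (\<forall>y<b. y \<in> set_decode u \<longrightarrow> dia_code y \<in> set_decode t) \<and>
     (\<forall>c<b. \<forall>y<b. lower_code c y \<in> set_decode t \<longrightarrow> y \<in> set_decode u \<longrightarrow> weight c \<le> w) \<and>
     (\<forall>c<b. \<forall>y<b. upper_code c y \<in> set_decode t \<longrightarrow> y \<in> set_decode u \<longrightarrow> w \<le> weight c)"

definition lower_weights :: "nat \<Rightarrow> nat \<Rightarrow> nat \<Rightarrow> real set" where
  "lower_weights b t u =
     weight ` {c. c < b \<and> (\<exists>y<b. lower_code c y \<in> set_decode t \<and> y \<in> set_decode u)}"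

definition upper_weights :: "nat \<Rightarrow> nat \<Rightarrow> nat \<Rightarrow> real set" where
  "upper_weights b t u =
     weight ` {c. c < b \<and> (\<exists>y<b. upper_code c y \<in> set_decode t \<and> y \<in> set_decode u)}"

lemma finite_lower_weights: "finite (lower_weights b t u)"
  and finite_upper_weights: "finite (upper_weights b t u)"
  by (simp_all add: lower_weights_def upper_weights_def)

text \<open>Compatibility takes care of the diamonds, which leaves an interval with finitely many
  prescribed bounds.\<close>

lemma admissible_iff:
  assumes "compatible b t u"
  shows "admissible b t u w \<longleftrightarrow>
    0 \<le> w \<and> (\<forall>v\<in>lower_weights b t u. v \<le> w) \<and> (\<forall>v\<in>upper_weights b t u. w \<le> v)"
  using assms
  by (fastforce simp: admissible_def lower_weights_def upper_weights_def compatible_def)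

lemma compatible_weights:
  assumes "compatible b t u" "v \<in> lower_weights b t u" "v' \<in> upper_weights b t u"
  shows "v \<le> v'"
  using assms by (auto simp: lower_weights_def upper_weights_def compatible_def)

lemma upper_weights_nonneg: "v \<in> upper_weights b t u \<Longrightarrow> 0 \<le> v"
  by (auto simp: upper_weights_def weight_nonneg)

text \<open>This is the left end of the interval: compatibility puts each lower bound below each
  upper bound, and upper bounds are nonnegative.\<close>

lemma admissible_Max:
  assumes "compatible b t u"
  shows "admissible b t u (Max (insert 0 (lower_weights b t u)))"
  using compatible_weights[OF assms] upper_weights_nonneg[of _ b t u] finite_lower_weights[of b t u]
  by (auto simp: admissible_iff[OF assms])

text \<open>The left end is the maximum of finitely many numbers below \<open>r\<close>. This will
  refute a formula \<open>Lower\<close>.\<close>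

lemma ex_admissible_less:
  assumes "compatible b t u" "0 < r" "\<And>v. v \<in> lower_weights b t u \<Longrightarrow> v < r"
  shows "\<exists>w<r. admissible b t u w"
  using admissible_Max[OF assms(1)] assms(2,3) finite_lower_weights[of b t u]
  by (intro exI[of _ "Max (insert 0 (lower_weights b t u))"]) auto

text \<open>The right end, if there is one, is the minimum of finitely many numbers above
  \<open>r\<close>. This will refute a formula \<open>Upper\<close>.\<close>

lemma ex_admissible_greater:
  assumes "compatible b t u" "0 \<le> r" "\<And>v. v \<in> upper_weights b t u \<Longrightarrow> r < v"
  shows "\<exists>w>r. admissible b t u w"
proof (cases "upper_weights b t u = {}")
  case True
  \<comment> \<open>Without upper bounds the interval extends to infinity; including
    \<open>r + 1\<close> pushes the chosen weight above \<open>r\<close> and keeps it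
    nonnegative.\<close>
  have "v \<le> Max (insert (r + 1) (lower_weights b t u))"
    if "v \<in> insert (r + 1) (lower_weights b t u)" for v
    using that finite_lower_weights[of b t u] by (intro Max_ge) auto
  then show ?thesis using assms(2) True
    by (intro exI[of _ "Max (insert (r + 1) (lower_weights b t u))"])
      (force simp: admissible_iff[OF assms(1)])
next
  case False
  then show ?thesis
    using assms finite_upper_weights[of b t u] compatible_weights[OF assms(1)] upper_weights_nonneg[of _ b t u]
    by (intro exI[of _ "Min (upper_weights b t u)"])
      (auto simp: admissible_iff[OF assms(1)])
qed

definition type_model :: "('ap \<Rightarrow> nat) \<Rightarrow> nat \<Rightarrow> nat \<Rightarrow> (nat, 'ap) wts" where
  "type_model c b W = \<lparr>states = set_decode W,
     trans = {(t, w, u). t \<in> set_decode W \<and> u \<in> set_decode W \<and> admissible b t u w},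
     label = \<lambda>t. {p. prod_encode (0, c p) \<in> set_decode t}\<rparr>"

lemma is_wts_type_model: "t \<in> set_decode W \<Longrightarrow> is_wts (type_model c b W)"
  by (auto simp: is_wts_def type_model_def admissible_def)

lemma saturatedD:
  assumes "saturated b W" "t \<in> set_decode W"
  shows "y < b \<Longrightarrow> neg_code y \<in> set_decode t \<longleftrightarrow> y \<notin> set_decode t"
    and "y < b \<Longrightarrow> z < b \<Longrightarrow>
      and_code y z \<in> set_decode t \<longleftrightarrow> y \<in> set_decode t \<and> z \<in> set_decode t"
    and "y < b \<Longrightarrow> dia_code y \<in> set_decode t \<Longrightarrow>
      \<exists>u\<in>set_decode W. y \<in> set_decode u \<and> compatible b t u"
    and "d < b \<Longrightarrow> y < b \<Longrightarrow> lower_code d y \<in> set_decode t \<Longrightarrow> dia_code y \<in> set_decode t"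
    and "d < b \<Longrightarrow> y < b \<Longrightarrow> upper_code d y \<in> set_decode t \<Longrightarrow> dia_code y \<in> set_decode t"
    and "d < b \<Longrightarrow> y < b \<Longrightarrow> lower_code d y \<notin> set_decode t \<Longrightarrow> dia_code y \<in> set_decode t \<Longrightarrow>
      0 < weight d \<and> (\<exists>u\<in>set_decode W. y \<in> set_decode u \<and> compatible b t u \<and>
        (\<forall>v\<in>lower_weights b t u. v < weight d))"
    and "d < b \<Longrightarrow> y < b \<Longrightarrow> upper_code d y \<notin> set_decode t \<Longrightarrow> dia_code y \<in> set_decode t \<Longrightarrow>
      \<exists>u\<in>set_decode W. y \<in> set_decode u \<and> compatible b t u \<and>
        (\<forall>v\<in>upper_weights b t u. weight d < v)"
proof -
  \<comment> \<open>Membership discharges the guard \<open>t<W\<close>, and \<open>weight 0\<close>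
    becomes \<open>0\<close>, so that the sixth clause speaks of positivity.\<close>
  note sat = assms(1)[unfolded saturated_def not_le weight_0, THEN spec, THEN mp, THEN mp,
      OF less_if_mem_set_decode[OF assms(2)] assms(2)]
  show "y < b \<Longrightarrow> neg_code y \<in> set_decode t \<longleftrightarrow> y \<notin> set_decode t"
    using sat[THEN conjunct1] by blast
  show "y < b \<Longrightarrow> z < b \<Longrightarrow>
      and_code y z \<in> set_decode t \<longleftrightarrow> y \<in> set_decode t \<and> z \<in> set_decode t"
    using sat[THEN conjunct2, THEN conjunct1] by blast
  show "y < b \<Longrightarrow> dia_code y \<in> set_decode t \<Longrightarrow>
      \<exists>u\<in>set_decode W. y \<in> set_decode u \<and> compatible b t u"
    using sat[THEN conjunct2, THEN conjunct2, THEN conjunct1] by blast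
  show "d < b \<Longrightarrow> y < b \<Longrightarrow> lower_code d y \<in> set_decode t \<Longrightarrow> dia_code y \<in> set_decode t"
    using sat[THEN conjunct2, THEN conjunct2, THEN conjunct2, THEN conjunct1] by blast
  show "d < b \<Longrightarrow> y < b \<Longrightarrow> upper_code d y \<in> set_decode t \<Longrightarrow> dia_code y \<in> set_decode t"
    using sat[THEN conjunct2, THEN conjunct2, THEN conjunct2, THEN conjunct2, THEN conjunct1] by blast
  show "d < b \<Longrightarrow> y < b \<Longrightarrow> lower_code d y \<notin> set_decode t \<Longrightarrow> dia_code y \<in> set_decode t \<Longrightarrow>
      0 < weight d \<and> (\<exists>u\<in>set_decode W. y \<in> set_decode u \<and> compatible b t u \<and>
        (\<forall>v\<in>lower_weights b t u. v < weight d))"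
    unfolding lower_weights_def
    using sat[THEN conjunct2, THEN conjunct2, THEN conjunct2, THEN conjunct2, THEN conjunct2, THEN conjunct1] by blast
  show "d < b \<Longrightarrow> y < b \<Longrightarrow> upper_code d y \<notin> set_decode t \<Longrightarrow> dia_code y \<in> set_decode t \<Longrightarrow>
      \<exists>u\<in>set_decode W. y \<in> set_decode u \<and> compatible b t u \<and>
        (\<forall>v\<in>upper_weights b t u. weight d < v)"
    unfolding upper_weights_def
    using sat[THEN conjunct2, THEN conjunct2, THEN conjunct2, THEN conjunct2, THEN conjunct2, THEN conjunct2] by blast
qed

lemma form_code_less:
  "form_code c \<phi> < form_code c (Neg \<phi>)"
  "form_code c \<phi> < form_code c (And \<phi> \<psi>)" "form_code c \<psi> < form_code c (And \<phi> \<psi>)"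
  "form_code c \<phi> < form_code c (Lower r \<phi>)" "nnrat_code r < form_code c (Lower r \<phi>)"
  "form_code c \<phi> < form_code c (Upper r \<phi>)" "nnrat_code r < form_code c (Upper r \<phi>)"
  by (simp_all add: less_prod_encode less_prod_encode_nested)

text \<open>The truth lemma. Positive modal formulae hold because all weights are admissible;
  negated ones are witnessed at or beyond an end of an interval. Subformulae and rationals have
  smaller codes, so the bound \<open>b\<close> is inherited.\<close>

lemma models_type_model:
  assumes sat: "saturated b W"
  shows "t \<in> set_decode W \<Longrightarrow> form_code c \<phi> < b \<Longrightarrow>
    models (type_model c b W) t \<phi> \<longleftrightarrow> form_code c \<phi> \<in> set_decode t"
proof (induction \<phi> arbitrary: t)
  case (Atom p)
  then show ?case by (simp add: type_model_def)
next
  case (Neg \<phi>)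
  have "form_code c \<phi> < b" using Neg.prems(2) form_code_less(1) by (rule order.strict_trans[rotated])
  then show ?case using Neg saturatedD(1)[OF sat] by simp
next
  case (And \<phi> \<psi>)
  have "form_code c \<phi> < b" "form_code c \<psi> < b"
    using And.prems(2) form_code_less(2,3) by (blast intro: order.strict_trans)+
  then show ?case using And saturatedD(2)[OF sat] by simp
next
  case (Lower r \<phi>)
  let ?M = "type_model c b W" and ?y = "form_code c \<phi>" and ?d = "nnrat_code r"
  have lt: "?y < b" "?d < b"
    using Lower.prems(2) form_code_less(4,5) by (blast intro: order.strict_trans)+
  note D = saturatedD[OF sat \<open>t \<in> set_decode W\<close>]
  have IH: "models ?M u \<phi> \<longleftrightarrow> ?y \<in> set_decode u" if "u \<in> set_decode W" for u
    using Lower.IH that lt by blast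
  have "models ?M t (Lower r \<phi>) \<longleftrightarrow>
      (\<exists>w. \<exists>u\<in>set_decode W. admissible b t u w \<and> ?y \<in> set_decode u) \<and>
      (\<forall>w. \<forall>u\<in>set_decode W. admissible b t u w \<longrightarrow> ?y \<in> set_decode u \<longrightarrow> weight ?d \<le> w)"
    unfolding models_Lower_iff[OF is_wts_type_model[OF \<open>t \<in> set_decode W\<close>]]
    using IH Lower.prems(1) by (auto simp: type_model_def)
  also have "\<dots> \<longleftrightarrow> lower_code ?d ?y \<in> set_decode t"
  proof (intro iffI conjI)
    assume l: "lower_code ?d ?y \<in> set_decode t"
    with D(3,4) lt obtain u where "u \<in> set_decode W" "?y \<in> set_decode u" "compatible b t u" by blast
    then show "\<exists>w. \<exists>u\<in>set_decode W. admissible b t u w \<and> ?y \<in> set_decode u"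
      using admissible_Max by blast
    show "\<forall>w. \<forall>u\<in>set_decode W. admissible b t u w \<longrightarrow> ?y \<in> set_decode u \<longrightarrow> weight ?d \<le> w"
      using l lt by (auto simp: admissible_def)
  next
    assume R: "(\<exists>w. \<exists>u\<in>set_decode W. admissible b t u w \<and> ?y \<in> set_decode u) \<and>
      (\<forall>w. \<forall>u\<in>set_decode W. admissible b t u w \<longrightarrow> ?y \<in> set_decode u \<longrightarrow> weight ?d \<le> w)"
    \<comment> \<open>An admissible transition into a type containing \<open>?y\<close> forces the
      diamond, by the second condition of \<open>admissible\<close>.\<close>
    then have dia: "dia_code ?y \<in> set_decode t" using lt by (auto simp: admissible_def)
    show "lower_code ?d ?y \<in> set_decode t"
    proof (rule ccontr)
      assume "lower_code ?d ?y \<notin> set_decode t"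
      \<comment> \<open>All lower bounds towards \<open>u\<close> lie below the refuted one, so the
        interval for \<open>u\<close> contains a weight below it.\<close>
      with D(6)[OF lt(2,1)] dia obtain u where "0 < weight ?d" "u \<in> set_decode W" "?y \<in> set_decode u"
        "compatible b t u" "\<forall>v\<in>lower_weights b t u. v < weight ?d" by blast
      with ex_admissible_less R show False by (meson not_le)
    qed
  qed
  finally show ?case by simp
next
  case (Upper r \<phi>)
  let ?M = "type_model c b W" and ?y = "form_code c \<phi>" and ?d = "nnrat_code r"
  have lt: "?y < b" "?d < b"
    using Upper.prems(2) form_code_less(6,7) by (blast intro: order.strict_trans)+
  note D = saturatedD[OF sat \<open>t \<in> set_decode W\<close>]
  have IH: "models ?M u \<phi> \<longleftrightarrow> ?y \<in> set_decode u" if "u \<in> set_decode W" for u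
    using Upper.IH that lt by blast
  have "models ?M t (Upper r \<phi>) \<longleftrightarrow>
      (\<exists>w. \<exists>u\<in>set_decode W. admissible b t u w \<and> ?y \<in> set_decode u) \<and>
      (\<forall>w. \<forall>u\<in>set_decode W. admissible b t u w \<longrightarrow> ?y \<in> set_decode u \<longrightarrow> w \<le> weight ?d)"
    unfolding models_Upper_iff[OF is_wts_type_model[OF \<open>t \<in> set_decode W\<close>]]
    using IH Upper.prems(1) by (auto simp: type_model_def)
  also have "\<dots> \<longleftrightarrow> upper_code ?d ?y \<in> set_decode t"
  proof (intro iffI conjI)
    assume l: "upper_code ?d ?y \<in> set_decode t"
    with D(3,5) lt obtain u where "u \<in> set_decode W" "?y \<in> set_decode u" "compatible b t u" by blast
    then show "\<exists>w. \<exists>u\<in>set_decode W. admissible b t u w \<and> ?y \<in> set_decode u"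
      using admissible_Max by blast
    show "\<forall>w. \<forall>u\<in>set_decode W. admissible b t u w \<longrightarrow> ?y \<in> set_decode u \<longrightarrow> w \<le> weight ?d"
      using l lt by (auto simp: admissible_def)
  next
    assume R: "(\<exists>w. \<exists>u\<in>set_decode W. admissible b t u w \<and> ?y \<in> set_decode u) \<and>
      (\<forall>w. \<forall>u\<in>set_decode W. admissible b t u w \<longrightarrow> ?y \<in> set_decode u \<longrightarrow> w \<le> weight ?d)"
    then have dia: "dia_code ?y \<in> set_decode t" using lt by (auto simp: admissible_def)
    show "upper_code ?d ?y \<in> set_decode t"
    proof (rule ccontr)
      assume "upper_code ?d ?y \<notin> set_decode t"
      \<comment> \<open>All upper bounds towards \<open>u\<close> lie above the refuted one, so the
        interval for \<open>u\<close> contains a weight above it.\<close>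
      with D(7)[OF lt(2,1)] dia obtain u where "u \<in> set_decode W" "?y \<in> set_decode u"
        "compatible b t u" "\<forall>v\<in>upper_weights b t u. weight ?d < v" by blast
      with ex_admissible_greater[OF _ weight_nonneg] R show False by (meson not_le)
    qed
  qed
  finally show ?case by simp
qed

lemma satisfiable_if_accepted:
  assumes "accepted (form_code c \<phi>)"
  shows "satisfiable TYPE(nat) \<phi>"
proof -
  let ?b = "Suc (form_code c \<phi>)"
  obtain W t where W: "saturated ?b W" and t: "t \<in> set_decode W" "form_code c \<phi> \<in> set_decode t"
    using assms by (auto simp: accepted_def)
  have "models (type_model c ?b W) t \<phi>"
    using models_type_model[OF W t(1), of c \<phi>] t(2) by simp
  then show ?thesis
    unfolding satisfiable_def using is_wts_type_model[OF t(1)] t(1)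
    by (intro exI[of _ "type_model c ?b W"]) (auto simp: type_model_def)
qed

subsection \<open>The types occurring in a model\<close>

text \<open>Codes are collected up to \<open>code_bound b\<close> instead of \<open>b\<close>, so
  that the type also decides every connective applied to codes below \<open>b\<close>.\<close>

definition state_type :: "('ap \<Rightarrow> nat) \<Rightarrow> ('s, 'ap) wts \<Rightarrow> nat \<Rightarrow> 's \<Rightarrow> nat" where
  "state_type c M b s = set_encode {y. y < code_bound b \<and> s \<in> denotation c M y}"

lemma less_code_bound:
  assumes "y < b"
  shows "y < code_bound b" "neg_code y < code_bound b" "dia_code y < code_bound b"
    "z < b \<Longrightarrow> and_code y z < code_bound b" "z < b \<Longrightarrow> lower_code y z < code_bound b"
    "z < b \<Longrightarrow> upper_code y z < code_bound b"
proof -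
  have p: "b \<le> prod_encode (b, b)" by (rule le_prod_encode_2)
  show "y < code_bound b" unfolding code_bound_def
    using assms p by (meson le_prod_encode_2 less_le_trans)
  show "neg_code y < code_bound b" "dia_code y < code_bound b" unfolding code_bound_def
    using assms p by (auto intro: prod_encode_strict_mono)
  show "and_code y z < code_bound b" "lower_code y z < code_bound b" "upper_code y z < code_bound b"
    if "z < b"
    unfolding code_bound_def using assms that by (auto intro!: prod_encode_strict_mono)
qed

lemma mem_state_type:
  "y \<in> set_decode (state_type c M b s) \<longleftrightarrow> y < code_bound b \<and> s \<in> denotation c M y"
  unfolding state_type_def by (subst set_encode_inverse) auto

text \<open>The weight \<open>w\<close> itself separates the bounds: every relevant lower bound is
  at most \<open>w\<close> and every relevant upper bound at least \<open>w\<close>.\<close>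

lemma compatible_state_type:
  assumes "(s, w, t) \<in> trans M"
  shows "compatible b (state_type c M b s) (state_type c M b t)"
  using assms unfolding compatible_def mem_state_type denotation_code
  by (auto simp: less_code_bound) (meson order_trans)

text \<open>\<open>W\<close> collects the types of all states. It is finite even for an infinite
  model, and each clause is witnessed by the type of an actual successor.\<close>

lemma ex_saturated:
  assumes M: "is_wts M"
  shows "\<exists>W<2 ^ 2 ^ code_bound b. saturated b W \<and> (\<forall>s\<in>states M. state_type c M b s \<in> set_decode W)"
proof -
  let ?T = "state_type c M b"
  define W where "W = set_encode (?T ` states M)"
  have sub: "?T ` states M \<subseteq> {..<2 ^ code_bound b}"
    unfolding state_type_def by (auto intro!: set_encode_less)
  then have dec: "set_decode W = ?T ` states M"
    unfolding W_def by (intro set_encode_inverse) (rule finite_subset, auto)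
  \<comment> \<open>\<open>P\<close> carries the further constraints on the target type that arise
    when a bound is refuted.\<close>
  have succ: "\<exists>u<W. u \<in> set_decode W \<and> y \<in> set_decode u \<and> compatible b (?T s) u \<and> P u"
    if "(s, w, t) \<in> trans M" "t \<in> denotation c M y" "y < b" "P (?T t)" for s w t y P
  proof (intro exI[of _ "?T t"] conjI)
    have "t \<in> states M" using M that(1) by (auto simp: is_wts_def)
    then show "?T t \<in> set_decode W" by (simp add: dec)
    then show "?T t < W" by (rule less_if_mem_set_decode)
  qed (use that compatible_state_type less_code_bound(1) in \<open>auto simp: mem_state_type\<close>)
  have "saturated b W"
    unfolding saturated_def
  proof (intro allI impI)
    fix t assume "t \<in> set_decode W"
    then obtain s where s: "s \<in> states M" "t = ?T s" by (auto simp: dec)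
    note mem = mem_state_type denotation_code less_code_bound
    have 1: "neg_code y \<in> set_decode t \<longleftrightarrow> y \<notin> set_decode t" if "y < b" for y
      using that by (simp add: s mem del: One_nat_def)
    have 2: "and_code y z \<in> set_decode t \<longleftrightarrow> y \<in> set_decode t \<and> z \<in> set_decode t"
      if "y < b" "z < b" for y z
      using that by (simp add: s mem)
    have 3: "\<exists>u<W. u \<in> set_decode W \<and> y \<in> set_decode u \<and> compatible b t u"
      if y: "y < b" "dia_code y \<in> set_decode t" for y
    proof -
      obtain w u where "(s, w, u) \<in> trans M" "u \<in> denotation c M y"
        using y by (auto simp: s mem)
      then show ?thesis using succ[of s w u y "\<lambda>_. True"] y s by simp
    qed
    have 4: "dia_code y \<in> set_decode t" if "d < b" "y < b" "lower_code d y \<in> set_decode t" for d y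
      using that by (auto simp: s mem)
    have 5: "dia_code y \<in> set_decode t" if "d < b" "y < b" "upper_code d y \<in> set_decode t" for d y
      using that by (auto simp: s mem)
    have 6: "\<not> weight d \<le> weight 0 \<and> (\<exists>u<W. u \<in> set_decode W \<and> y \<in> set_decode u \<and> compatible b t u \<and>
          (\<forall>d'<b. \<forall>z<b. lower_code d' z \<in> set_decode t \<and> z \<in> set_decode u \<longrightarrow> \<not> weight d \<le> weight d'))"
      if y: "d < b" "y < b" "lower_code d y \<notin> set_decode t \<and> dia_code y \<in> set_decode t" for d y
    proof -
      obtain w u where u: "(s, w, u) \<in> trans M" "u \<in> denotation c M y" "w < weight d"
        using y by (auto simp: s mem not_le)
      moreover have "0 \<le> w" using M u(1) by (auto simp: is_wts_def)
      moreover have "weight d' < weight d"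
        if "z < b" "d' < b" "lower_code d' z \<in> set_decode t" "z \<in> set_decode (?T u)" for d' z
      proof -
        \<comment> \<open>The lower bound \<open>d'\<close> holds at \<open>s\<close> and applies to
          the transition into \<open>u\<close>, whose weight \<open>w\<close> violates
          \<open>d\<close>.\<close>
        have "weight d' \<le> w" using that u(1) by (auto simp: s mem)
        then show ?thesis using u(3) by simp
      qed
      ultimately show ?thesis using s y
        by (auto simp: weight_0 not_le intro!: succ[of s w u y])
    qed
    have 7: "\<exists>u<W. u \<in> set_decode W \<and> y \<in> set_decode u \<and> compatible b t u \<and>
          (\<forall>d'<b. \<forall>z<b. upper_code d' z \<in> set_decode t \<and> z \<in> set_decode u \<longrightarrow> \<not> weight d' \<le> weight d)"
      if y: "d < b" "y < b" "upper_code d y \<notin> set_decode t \<and> dia_code y \<in> set_decode t" for d y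
    proof -
      obtain w u where u: "(s, w, u) \<in> trans M" "u \<in> denotation c M y" "weight d < w"
        using y by (auto simp: s mem not_le)
      moreover have "weight d < weight d'"
        if "z < b" "d' < b" "upper_code d' z \<in> set_decode t" "z \<in> set_decode (?T u)" for d' z
      proof -
        have "w \<le> weight d'" using that u(1) by (auto simp: s mem)
        then show ?thesis using u(3) by simp
      qed
      ultimately show ?thesis using s y
        by (auto simp: not_le intro!: succ[of s w u y])
    qed
    show "(\<forall>y<b. neg_code y \<in> set_decode t \<longleftrightarrow> y \<notin> set_decode t) \<and>
     (\<forall>y<b. \<forall>z<b. and_code y z \<in> set_decode t \<longleftrightarrow> y \<in> set_decode t \<and> z \<in> set_decode t) \<and>
     (\<forall>y<b. dia_code y \<in> set_decode t \<longrightarrow>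
        (\<exists>u<W. u \<in> set_decode W \<and> y \<in> set_decode u \<and> compatible b t u)) \<and>
     (\<forall>c<b. \<forall>y<b. lower_code c y \<in> set_decode t \<longrightarrow> dia_code y \<in> set_decode t) \<and>
     (\<forall>c<b. \<forall>y<b. upper_code c y \<in> set_decode t \<longrightarrow> dia_code y \<in> set_decode t) \<and>
     (\<forall>c<b. \<forall>y<b. lower_code c y \<notin> set_decode t \<and> dia_code y \<in> set_decode t \<longrightarrow>
        \<not> weight c \<le> weight 0 \<and>
        (\<exists>u<W. u \<in> set_decode W \<and> y \<in> set_decode u \<and> compatible b t u \<and>
          (\<forall>d<b. \<forall>z<b. lower_code d z \<in> set_decode t \<and> z \<in> set_decode u \<longrightarrow>
             \<not> weight c \<le> weight d))) \<and>
     (\<forall>c<b. \<forall>y<b. upper_code c y \<notin> set_decode t \<and> dia_code y \<in> set_decode t \<longrightarrow>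
        (\<exists>u<W. u \<in> set_decode W \<and> y \<in> set_decode u \<and> compatible b t u \<and>
          (\<forall>d<b. \<forall>z<b. upper_code d z \<in> set_decode t \<and> z \<in> set_decode u \<longrightarrow>
             \<not> weight d \<le> weight c)))"
      by (intro conjI allI impI; (rule 1 2 3 4 5 6[THEN conjunct1] 6[THEN conjunct2] 7; assumption))
  qed
  moreover have "W < 2 ^ 2 ^ code_bound b" unfolding W_def using sub by (rule set_encode_less)
  ultimately show ?thesis by (auto simp: dec)
qed

text \<open>The type of states is arbitrary here: over \<open>nat\<close> this is completeness of
  the test, over any other type it yields the transfer to \<open>nat\<close>.\<close>

lemma accepted_if_satisfiable:
  fixes \<phi> :: "'ap form"
  assumes "inj c" "satisfiable TYPE('s) \<phi>"
  shows "accepted (form_code c \<phi>)"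
proof -
  obtain M :: "('s, 'ap) wts" and s where M: "is_wts M" and s: "s \<in> states M" "models M s \<phi>"
    using assms(2) by (auto simp: satisfiable_def)
  let ?b = "Suc (form_code c \<phi>)"
  obtain W where W: "W < 2 ^ 2 ^ code_bound ?b" "saturated ?b W" "state_type c M ?b s \<in> set_decode W"
    using ex_saturated[OF M] s(1) by blast
  have "form_code c \<phi> \<in> set_decode (state_type c M ?b s)"
    using s(2) by (simp add: mem_state_type denotation_form_code[OF M assms(1)] less_code_bound)
  with W show ?thesis unfolding accepted_def using less_if_mem_set_decode by blast
qed

theorem theorem5p8:
  fixes ap_code :: "'ap \<Rightarrow> nat"
  assumes "inj ap_code"
  shows "decidable (form_code ap_code) {\<phi> :: 'ap form. satisfiable TYPE(nat) \<phi>} \<and>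
         (\<forall>\<phi> :: 'ap form. satisfiable TYPE('s) \<phi> \<longrightarrow> satisfiable TYPE(nat) \<phi>)"
proof
  have iff: "satisfiable TYPE(nat) \<phi> \<longleftrightarrow> accepted (form_code ap_code \<phi>)" for \<phi> :: "'ap form"
    using accepted_if_satisfiable[OF assms] satisfiable_if_accepted by blast
  \<comment> \<open>\<open>decidable\<close> answers \<open>1\<close> for membership, whereas
    \<open>decidable_pred\<close> uses \<open>0\<close> for truth, so the values are
    exchanged.\<close>
  have "computable 1 (\<lambda>e. if accepted (e 0) then 1 else 0)"
    by (intro computable_if computable_const decidable_pred_accepted)
  then obtain f where "total_recursive 1 f"
    "\<And>xs. length xs = 1 \<Longrightarrow> f xs = (if accepted (xs ! 0) then 1 else 0)"
    by (auto simp: computable_def)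
  then show "decidable (form_code ap_code) {\<phi> :: 'ap form. satisfiable TYPE(nat) \<phi>}"
    unfolding decidable_def by (intro exI[of _ f]) (simp add: iff)
  show "\<forall>\<phi> :: 'ap form. satisfiable TYPE('s) \<phi> \<longrightarrow> satisfiable TYPE(nat) \<phi>"
    using accepted_if_satisfiable[OF assms] satisfiable_if_accepted by blast
qed

end
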